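(* The following statements hold. (1) Let $Q$ be a right-orderable quandle, $A$ a linearly ordered set and $\alpha:Q\times Q\to\operatorname{Map}(A\times A,A)$ a dynamical 2-cocycle. If $\alpha_{x,y}:A\times A\to A$ is order-preserving for all $x,y\in Q$ (where $A\times A$ carries the lexicographic order), then the quandle $Q\times_\alpha A$ is right-orderable. (2) If $Q$ is a right-orderable quandle, $A$ a right-orderable abelian group and $\alpha:Q\times Q\to A$ a normalized quandle 2-cocycle, then the abelian extension $Q\times_\alpha A$ is right-orderable. (3) If $Q$ is a quandle, $A$ a non-trivial abelian group and $\alpha:Q\times Q\to A$ a normalized quandle 2-cocycle, then the abelian extension $Q\times_\alpha A$ is not left-orderable.
   Context: A quandle is a non-empty set $Q$ with a binary operation $*$ such that $x*x=x$; for all $x,y$ there is a unique $z$ with $x=z*y$; and $(x*y)*z=(x*z)*(y*z)$. A quandle is left-orderable (resp. right-orderable) if it has a (strict) linear order $<$ such that $x<y$ implies $z*x<z*y$ (resp. $x*z<y*z$) for all $x,y,z$. A right-orderable group is a group with a linear order preserved by right multiplications. $\operatorname{Map}(A\times A,A)$ is the set of maps $A\times A\to A$. For a quandle $Q$ and a set $A$, a dynamical 2-cocycle is a map $\alpha:Q\times Q\to\operatorname{Map}(A\times A,A)$, $(x,y)\mapsto\alpha_{x,y}$, such that for all $x,y,z\in Q$ and $s,t,u\in A$: $\alpha_{x,x}(s,s)=s$; the map $\alpha_{x,y}(-,t):A\to A$ is a bijection; and $\alpha_{x*y,z}(\alpha_{x,y}(s,t),u)=\alpha_{x*z,y*z}(\alpha_{x,z}(s,u),\alpha_{y,z}(t,u))$.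 Then $Q\times_\alpha A$ is the quandle on $Q\times A$ with operation $(x,s)*(y,t)=(x*y,\alpha_{x,y}(s,t))$. A map $f$ between linearly ordered sets is order-preserving if $p\le q$ implies $f(p)\le f(q)$. For an abelian group $A$ (written multiplicatively), a normalized quandle 2-cocycle is a map $\alpha:Q\times Q\to A$ with $\alpha_{x,y}\,\alpha_{x*y,z}=\alpha_{x,z}\,\alpha_{x*z,y*z}$ and $\alpha_{x,x}=1$ for all $x,y,z\in Q$; the abelian extension $Q\times_\alpha A$ is the quandle on $Q\times A$ with operation $(x,s)*(y,t)=(x*y,\,s\,\alpha_{x,y})$. *)

theory Defs
  imports "HOL-Algebra.Group"
begin

locale quandle =
  fixes Q :: "'q set" and qop :: "'q \<Rightarrow> 'q \<Rightarrow> 'q"  (infixl "\<star>" 70)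
  assumes nonempty: "Q \<noteq> {}"
    and closed: "\<And>x y. x \<in> Q \<Longrightarrow> y \<in> Q \<Longrightarrow> x \<star> y \<in> Q"
    and idem: "\<And>x. x \<in> Q \<Longrightarrow> x \<star> x = x"
    and right_divisible: "\<And>x y. x \<in> Q \<Longrightarrow> y \<in> Q \<Longrightarrow> \<exists>!z. z \<in> Q \<and> x = z \<star> y"
    and right_distrib:
      "\<And>x y z. x \<in> Q \<Longrightarrow> y \<in> Q \<Longrightarrow> z \<in> Q \<Longrightarrow> (x \<star> y) \<star> z = (x \<star> z) \<star> (y \<star> z)"

text \<open>
  The two orderability predicates do not contain the quandle axioms, so that a negated
  occurrence speaks about orders only.
\<close>

definition left_orderable :: "'q set \<Rightarrow> ('q \<Rightarrow> 'q \<Rightarrow> 'q) \<Rightarrow> bool" where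
  "left_orderable Q qop \<longleftrightarrow>
     (\<exists>r. strict_linear_order_on Q r \<and>
          (\<forall>x\<in>Q. \<forall>y\<in>Q. \<forall>z\<in>Q. (x, y) \<in> r \<longrightarrow> (qop z x, qop z y) \<in> r))"

definition right_orderable :: "'q set \<Rightarrow> ('q \<Rightarrow> 'q \<Rightarrow> 'q) \<Rightarrow> bool" where
  "right_orderable Q qop \<longleftrightarrow>
     (\<exists>r. strict_linear_order_on Q r \<and>
          (\<forall>x\<in>Q. \<forall>y\<in>Q. \<forall>z\<in>Q. (x, y) \<in> r \<longrightarrow> (qop x z, qop y z) \<in> r))"

definition right_orderable_group :: "('a, 'm) monoid_scheme \<Rightarrow> bool" where
  "right_orderable_group G \<longleftrightarrow> group G \<and>
     (\<exists>r. strict_linear_order_on (carrier G) r \<and>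
          (\<forall>x\<in>carrier G. \<forall>y\<in>carrier G. \<forall>z\<in>carrier G.
             (x, y) \<in> r \<longrightarrow> (x \<otimes>\<^bsub>G\<^esub> z, y \<otimes>\<^bsub>G\<^esub> z) \<in> r))"

definition dynamical_cocycle ::
    "'q set \<Rightarrow> ('q \<Rightarrow> 'q \<Rightarrow> 'q) \<Rightarrow> 'a set \<Rightarrow> ('q \<Rightarrow> 'q \<Rightarrow> 'a \<times> 'a \<Rightarrow> 'a) \<Rightarrow> bool" where
  "dynamical_cocycle Q qop A \<alpha> \<longleftrightarrow>
     (\<forall>x\<in>Q. \<forall>y\<in>Q. \<alpha> x y \<in> A \<times> A \<rightarrow> A) \<and>
     (\<forall>x\<in>Q. \<forall>s\<in>A. \<alpha> x x (s, s) = s) \<and>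
     (\<forall>x\<in>Q. \<forall>y\<in>Q. \<forall>t\<in>A. bij_betw (\<lambda>s. \<alpha> x y (s, t)) A A) \<and>
     (\<forall>x\<in>Q. \<forall>y\<in>Q. \<forall>z\<in>Q. \<forall>s\<in>A. \<forall>t\<in>A. \<forall>u\<in>A.
        \<alpha> (qop x y) z (\<alpha> x y (s, t), u) =
        \<alpha> (qop x z) (qop y z) (\<alpha> x z (s, u), \<alpha> y z (t, u)))"

definition dynamical_ext ::
    "('q \<Rightarrow> 'q \<Rightarrow> 'q) \<Rightarrow> ('q \<Rightarrow> 'q \<Rightarrow> 'a \<times> 'a \<Rightarrow> 'a) \<Rightarrow> 'q \<times> 'a \<Rightarrow> 'q \<times> 'a \<Rightarrow> 'q \<times> 'a" where
  "dynamical_ext qop \<alpha> = (\<lambda>(x, s) (y, t). (qop x y, \<alpha> x y (s, t)))"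

definition normalized_cocycle ::
    "'q set \<Rightarrow> ('q \<Rightarrow> 'q \<Rightarrow> 'q) \<Rightarrow> ('a, 'm) monoid_scheme \<Rightarrow> ('q \<Rightarrow> 'q \<Rightarrow> 'a) \<Rightarrow> bool" where
  "normalized_cocycle Q qop G \<alpha> \<longleftrightarrow>
     (\<forall>x\<in>Q. \<forall>y\<in>Q. \<alpha> x y \<in> carrier G) \<and>
     (\<forall>x\<in>Q. \<forall>y\<in>Q. \<forall>z\<in>Q.
        \<alpha> x y \<otimes>\<^bsub>G\<^esub> \<alpha> (qop x y) z = \<alpha> x z \<otimes>\<^bsub>G\<^esub> \<alpha> (qop x z) (qop y z)) \<and>
     (\<forall>x\<in>Q. \<alpha> x x = \<one>\<^bsub>G\<^esub>)"

definition abelian_ext ::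
    "('q \<Rightarrow> 'q \<Rightarrow> 'q) \<Rightarrow> ('a, 'm) monoid_scheme \<Rightarrow> ('q \<Rightarrow> 'q \<Rightarrow> 'a) \<Rightarrow>
     'q \<times> 'a \<Rightarrow> 'q \<times> 'a \<Rightarrow> 'q \<times> 'a" where
  "abelian_ext qop G \<alpha> = (\<lambda>(x, s) (y, t). (qop x y, s \<otimes>\<^bsub>G\<^esub> \<alpha> x y))"

text \<open>
  Here \<open>r\<close> is the strict order on \<open>A\<close>; the weak orders on \<open>A\<close> and
  (lexicographically) on \<open>A \<times> A\<close> are the reflexive closures.
\<close>

definition lex_order_preserving :: "'a set \<Rightarrow> 'a rel \<Rightarrow> ('a \<times> 'a \<Rightarrow> 'a) \<Rightarrow> bool" where
  "lex_order_preserving A r f \<longleftrightarrow>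
     monotone_on (A \<times> A) (\<lambda>p q. (p, q) \<in> (r <*lex*> r)\<^sup>=) (\<lambda>s t. (s, t) \<in> r\<^sup>=) f"

end

theory Submission
  imports Defs
begin

text \<open>
  An abelian extension is the dynamical extension for the maps \<open>(s, t) \<mapsto> s \<otimes> \<alpha> x y\<close>.
  Under the hypotheses of (1), the lexicographic order on \<open>Q \<times> A\<close> is right-invariant:
  bijectivity of \<open>\<alpha> x y (-, t)\<close> makes the weak monotonicity strict in the first argument.
  Part (2) is a special case of (1). For (3), \<open>(x, \<one>) * (x, a)\<close> does not depend on \<open>a\<close>, so left
  translations are not injective.
\<close>

text \<open>Totality compares first coordinates and falls back on the second ones when these agree.
  This supplies the order on the underlying set of an extension, with the quandle coordinate
  dominant.\<close>

lemma strict_linear_order_on_lex_prod: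
  assumes "strict_linear_order_on A r" "strict_linear_order_on B s"
  shows "strict_linear_order_on (A \<times> B) (r <*lex*> s)"
  using assms unfolding strict_linear_order_on_def irrefl_def total_on_def
  by auto

text \<open>Each axiom splits into coordinates. The first coordinate is the same axiom in
  \<open>Q\<close>; the second is one clause on \<alpha>: \<open>diag\<close> for idempotence,
  \<open>bij\<close> for right division, \<open>cocycle\<close> for distributivity.\<close>

lemma quandle_dynamical_ext:
  assumes "quandle Q qop" "A \<noteq> {}" "dynamical_cocycle Q qop A \<alpha>"
  shows "quandle (Q \<times> A) (dynamical_ext qop \<alpha>)"
proof -
  interpret quandle Q qop by fact
  have maps: "\<alpha> x y (s, t) \<in> A" if "x \<in> Q" "y \<in> Q" "s \<in> A" "t \<in> A" for x y s t
    using assms(3) that unfolding dynamical_cocycle_def by blast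
  have diag: "\<alpha> x x (s, s) = s" if "x \<in> Q" "s \<in> A" for x s
    using assms(3) that unfolding dynamical_cocycle_def by blast
  have bij: "bij_betw (\<lambda>s. \<alpha> x y (s, t)) A A" if "x \<in> Q" "y \<in> Q" "t \<in> A" for x y t
    using assms(3) that unfolding dynamical_cocycle_def by blast
  have cocycle: "\<alpha> (qop x y) z (\<alpha> x y (s, t), u) =
      \<alpha> (qop x z) (qop y z) (\<alpha> x z (s, u), \<alpha> y z (t, u))"
    if "x \<in> Q" "y \<in> Q" "z \<in> Q" "s \<in> A" "t \<in> A" "u \<in> A" for x y z s t u
    using assms(3) that unfolding dynamical_cocycle_def by blast
  show ?thesis
  proof
    show "Q \<times> A \<noteq> {}"
      using nonempty assms(2) by simp
  next
    fix p q assume "p \<in> Q \<times> A" "q \<in> Q \<times> A"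
    then show "dynamical_ext qop \<alpha> p q \<in> Q \<times> A"
      by (auto simp: dynamical_ext_def closed maps)
  next
    fix p assume "p \<in> Q \<times> A"
    then show "dynamical_ext qop \<alpha> p p = p"
      by (auto simp: dynamical_ext_def idem diag)
  next
    fix p q assume "p \<in> Q \<times> A" "q \<in> Q \<times> A"
    then obtain x s y t where pq: "p = (x, s)" "q = (y, t)"
      and mem: "x \<in> Q" "s \<in> A" "y \<in> Q" "t \<in> A"
      by auto
    obtain z where z: "z \<in> Q" "x = qop z y" and z_unique: "\<And>z'. z' \<in> Q \<Longrightarrow> x = qop z' y \<Longrightarrow> z' = z"
      using right_divisible[OF mem(1,3)] by blast
    \<comment> \<open>The map to be inverted is indexed by the quotient \<open>z\<close>, not by
      \<open>x\<close>, so the first coordinate has to be divided before the second.\<close>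
    obtain w where w: "w \<in> A" "s = \<alpha> z y (w, t)"
      using bij_betw_imp_surj_on[OF bij[OF z(1) mem(3,4)]] mem(2) by blast
    show "\<exists>!c. c \<in> Q \<times> A \<and> p = dynamical_ext qop \<alpha> c q"
    proof
      show "(z, w) \<in> Q \<times> A \<and> p = dynamical_ext qop \<alpha> (z, w) q"
        using z w by (simp add: pq dynamical_ext_def)
    next
      fix c assume c: "c \<in> Q \<times> A \<and> p = dynamical_ext qop \<alpha> c q"
      then obtain z' w' where c_eq: "c = (z', w')" and "z' \<in> Q" "w' \<in> A"
        by auto
      with c have "x = qop z' y" "s = \<alpha> z' y (w', t)"
        by (auto simp: pq dynamical_ext_def)
      \<comment> \<open>Uniqueness in \<open>Q\<close> comes first: only once \<open>z' = z\<close>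
        are both second coordinates values of one injective map, which then gives
        \<open>w' = w\<close>.\<close>
      with z_unique \<open>z' \<in> Q\<close> have "z' = z" "\<alpha> z y (w', t) = \<alpha> z y (w, t)"
        using w by auto
      moreover have "w' = w"
        using inj_onD[OF bij_betw_imp_inj_on[OF bij[OF z(1) mem(3,4)]]] calculation(2) \<open>w' \<in> A\<close> w(1)
        by blast
      ultimately show "c = (z, w)"
        by (simp add: c_eq)
    qed
  next
    fix p q c assume "p \<in> Q \<times> A" "q \<in> Q \<times> A" "c \<in> Q \<times> A"
    then obtain x s y t z u where pqc: "p = (x, s)" "q = (y, t)" "c = (z, u)"
      and "x \<in> Q" "y \<in> Q" "z \<in> Q" "s \<in> A" "t \<in> A" "u \<in> A"
      by auto
    then show "dynamical_ext qop \<alpha> (dynamical_ext qop \<alpha> p q) c =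
        dynamical_ext qop \<alpha> (dynamical_ext qop \<alpha> p c) (dynamical_ext qop \<alpha> q c)"
      unfolding pqc dynamical_ext_def prod.case by (intro arg_cong2[where f = Pair] right_distrib cocycle)
  qed
qed

text \<open>If first coordinates differ, invariance of the order on \<open>Q\<close> decides. If
  they agree, both second coordinates pass through the same map \<open>\<alpha> x z (-, u)\<close>,
  which is strictly increasing.\<close>

lemma right_orderable_dynamical_ext:
  assumes "right_orderable Q qop" "strict_linear_order_on A r" "dynamical_cocycle Q qop A \<alpha>"
    and pres: "\<And>x y. x \<in> Q \<Longrightarrow> y \<in> Q \<Longrightarrow> lex_order_preserving A r (\<alpha> x y)"
  shows "right_orderable (Q \<times> A) (dynamical_ext qop \<alpha>)"
proof -
  obtain R where R: "strict_linear_order_on Q R"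
    and inv: "\<And>x y z. x \<in> Q \<Longrightarrow> y \<in> Q \<Longrightarrow> z \<in> Q \<Longrightarrow> (x, y) \<in> R \<Longrightarrow> (qop x z, qop y z) \<in> R"
    using assms(1) unfolding right_orderable_def by blast
  have strict: "(\<alpha> x z (s, u), \<alpha> x z (t, u)) \<in> r"
    if "x \<in> Q" "z \<in> Q" "s \<in> A" "t \<in> A" "u \<in> A" "(s, t) \<in> r" for x z s t u
  proof -
    \<comment> \<open>The pairs \<open>(s, u)\<close> and \<open>(t, u)\<close> already differ in
      the dominant coordinate, so they are in lexicographic order. Only a weak inequality results;
      injectivity below excludes equality.\<close>
    have "(\<alpha> x z (s, u), \<alpha> x z (t, u)) \<in> r\<^sup>="
      using monotone_onD[OF pres[OF that(1,2), unfolded lex_order_preserving_def],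
          of "(s, u)" "(t, u)"] that(3-) by simp
    moreover have "inj_on (\<lambda>s. \<alpha> x z (s, u)) A"
      using assms(3) that unfolding dynamical_cocycle_def by (blast intro: bij_betw_imp_inj_on)
    moreover have "s \<noteq> t"
      using assms(2) that(6) by (auto simp: strict_linear_order_on_def irrefl_def)
    ultimately show ?thesis
      using that(3,4) by (auto dest: inj_onD)
  qed
  show ?thesis
    unfolding right_orderable_def
  proof (intro exI conjI ballI impI)
    show "strict_linear_order_on (Q \<times> A) (R <*lex*> r)"
      using R assms(2) by (rule strict_linear_order_on_lex_prod)
  next
    fix p q c assume "p \<in> Q \<times> A" "q \<in> Q \<times> A" "c \<in> Q \<times> A" "(p, q) \<in> R <*lex*> r"
    then show "(dynamical_ext qop \<alpha> p c, dynamical_ext qop \<alpha> q c) \<in> R <*lex*> r"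
      by (auto simp: dynamical_ext_def inv strict)
  qed
qed

lemma abelian_ext_eq_dynamical_ext:
  "abelian_ext qop G \<alpha> = dynamical_ext qop (\<lambda>x y (s, t). s \<otimes>\<^bsub>G\<^esub> \<alpha> x y)"
  by (simp add: abelian_ext_def dynamical_ext_def)

text \<open>Right multiplication by a fixed group element is a bijection, normalization gives the
  diagonal clause, and the dynamical identity is the 2-cocycle identity multiplied on the left by
  \<open>s\<close>.\<close>

lemma dynamical_cocycle_of_normalized_cocycle:
  assumes "group G" "normalized_cocycle Q qop G \<alpha>" "quandle Q qop"
  shows "dynamical_cocycle Q qop (carrier G) (\<lambda>x y (s, t). s \<otimes>\<^bsub>G\<^esub> \<alpha> x y)"
proof -
  interpret group G by fact
  interpret quandle Q qop by fact
  have mem: "\<alpha> x y \<in> carrier G" if "x \<in> Q" "y \<in> Q" for x y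
    using assms(2) that unfolding normalized_cocycle_def by blast
  have cocycle: "\<alpha> x y \<otimes>\<^bsub>G\<^esub> \<alpha> (qop x y) z = \<alpha> x z \<otimes>\<^bsub>G\<^esub> \<alpha> (qop x z) (qop y z)"
    if "x \<in> Q" "y \<in> Q" "z \<in> Q" for x y z
    using assms(2) that unfolding normalized_cocycle_def by blast
  have bij: "bij_betw (\<lambda>s. s \<otimes>\<^bsub>G\<^esub> \<alpha> x y) (carrier G) (carrier G)" if "x \<in> Q" "y \<in> Q" for x y
    by (rule bij_betw_byWitness[where f' = "\<lambda>s. s \<otimes>\<^bsub>G\<^esub> inv\<^bsub>G\<^esub> \<alpha> x y"])
      (use mem[OF that] in \<open>auto simp: m_assoc\<close>)
  have diag: "\<alpha> x x = \<one>\<^bsub>G\<^esub>" if "x \<in> Q" for x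
    using assms(2) that unfolding normalized_cocycle_def by blast
  have cocycle': "s \<otimes>\<^bsub>G\<^esub> \<alpha> x y \<otimes>\<^bsub>G\<^esub> \<alpha> (qop x y) z = s \<otimes>\<^bsub>G\<^esub> \<alpha> x z \<otimes>\<^bsub>G\<^esub> \<alpha> (qop x z) (qop y z)"
    if "x \<in> Q" "y \<in> Q" "z \<in> Q" "s \<in> carrier G" for x y z s
    using cocycle[OF that(1-3)] that by (simp add: m_assoc mem closed)
  show ?thesis
    unfolding dynamical_cocycle_def prod.case
  proof (intro conjI ballI)
    show "(\<lambda>(s, t). s \<otimes>\<^bsub>G\<^esub> \<alpha> x y) \<in> carrier G \<times> carrier G \<rightarrow> carrier G" if "x \<in> Q" "y \<in> Q" for x y
      by (auto simp: mem[OF that])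
  qed (auto simp: diag intro: bij cocycle')
qed

lemma quandle_abelian_ext:
  assumes "quandle Q qop" "group G" "normalized_cocycle Q qop G \<alpha>"
  shows "quandle (Q \<times> carrier G) (abelian_ext qop G \<alpha>)"
  unfolding abelian_ext_eq_dynamical_ext
  \<comment> \<open>The unit witnesses that the fibre \<open>carrier G\<close> is non-empty.\<close>
  using assms monoid.one_closed[OF group.is_monoid[OF assms(2)]]
  by (intro quandle_dynamical_ext dynamical_cocycle_of_normalized_cocycle) auto

lemma right_orderable_abelian_ext:
  assumes "quandle Q qop" "right_orderable Q qop" "right_orderable_group G"
    and "normalized_cocycle Q qop G \<alpha>"
  shows "right_orderable (Q \<times> carrier G) (abelian_ext qop G \<alpha>)"
proof -
  obtain r where "group G" and r: "strict_linear_order_on (carrier G) r"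
    and inv: "\<And>x y z. x \<in> carrier G \<Longrightarrow> y \<in> carrier G \<Longrightarrow> z \<in> carrier G \<Longrightarrow>
      (x, y) \<in> r \<Longrightarrow> (x \<otimes>\<^bsub>G\<^esub> z, y \<otimes>\<^bsub>G\<^esub> z) \<in> r"
    using assms(3) unfolding right_orderable_group_def by blast
  have "lex_order_preserving (carrier G) r (\<lambda>(s, t). s \<otimes>\<^bsub>G\<^esub> \<alpha> x y)" if "x \<in> Q" "y \<in> Q" for x y
  proof -
    have "\<alpha> x y \<in> carrier G"
      using assms(4) that unfolding normalized_cocycle_def by blast
    \<comment> \<open>Of two lexicographically comparable pairs, the first entries are equal or
      strictly ordered; right multiplication by \<open>\<alpha> x y\<close> preserves either
      relation.\<close>
    then show ?thesis
      unfolding lex_order_preserving_def by (auto intro!: monotone_onI inv)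
  qed
  then show ?thesis
    unfolding abelian_ext_eq_dynamical_ext
    using assms r \<open>group G\<close>
    by (intro right_orderable_dynamical_ext dynamical_cocycle_of_normalized_cocycle) auto
qed

lemma not_left_orderable_abelian_ext:
  assumes "Q \<noteq> {}" "group G" "carrier G \<noteq> {\<one>\<^bsub>G\<^esub>}"
  shows "\<not> left_orderable (Q \<times> carrier G) (abelian_ext qop G \<alpha>)"
proof
  assume "left_orderable (Q \<times> carrier G) (abelian_ext qop G \<alpha>)"
  then obtain r where r: "strict_linear_order_on (Q \<times> carrier G) r"
    and inv: "\<And>p q c. p \<in> Q \<times> carrier G \<Longrightarrow> q \<in> Q \<times> carrier G \<Longrightarrow> c \<in> Q \<times> carrier G \<Longrightarrow>
      (p, q) \<in> r \<Longrightarrow> (abelian_ext qop G \<alpha> c p, abelian_ext qop G \<alpha> c q) \<in> r"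
    unfolding left_orderable_def by blast
  interpret group G by fact
  obtain x where "x \<in> Q"
    using assms(1) by blast
  obtain a where "a \<in> carrier G" "a \<noteq> \<one>\<^bsub>G\<^esub>"
    using assms(3) one_closed by blast
  have p: "(x, \<one>\<^bsub>G\<^esub>) \<in> Q \<times> carrier G" and q: "(x, a) \<in> Q \<times> carrier G"
    using \<open>x \<in> Q\<close> \<open>a \<in> carrier G\<close> by auto
  \<comment> \<open>The operation never reads the group component of its right argument.\<close>
  have eq: "abelian_ext qop G \<alpha> (x, \<one>\<^bsub>G\<^esub>) (x, a) = abelian_ext qop G \<alpha> (x, \<one>\<^bsub>G\<^esub>) (x, \<one>\<^bsub>G\<^esub>)"
    by (simp add: abelian_ext_def)
  have "((x, \<one>\<^bsub>G\<^esub>), (x, a)) \<in> r \<or> ((x, a), (x, \<one>\<^bsub>G\<^esub>)) \<in> r"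
    using r p q \<open>a \<noteq> \<one>\<^bsub>G\<^esub>\<close> unfolding strict_linear_order_on_def total_on_def by blast
  \<comment> \<open>Whichever way the two distinct points compare, left translation by
    \<open>(x, \<one>)\<close> merges them, so a point would lie strictly below itself.\<close>
  then have "(abelian_ext qop G \<alpha> (x, \<one>\<^bsub>G\<^esub>) (x, \<one>\<^bsub>G\<^esub>), abelian_ext qop G \<alpha> (x, \<one>\<^bsub>G\<^esub>) (x, \<one>\<^bsub>G\<^esub>)) \<in> r"
    using inv[OF p q p] inv[OF q p p] unfolding eq by blast
  then show False
    using r unfolding strict_linear_order_on_def irrefl_def by blast
qed

text \<open>The orderability predicates speak of orders only, so each part also asserts that the
  extension is a quandle; as quandles are non-empty, the first part asks for
  \<open>A \<noteq> {}\<close>. Separate type variables keep the three coefficient types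
  independent.\<close>

theorem proposition4p5:
  fixes Q :: "'q set" and qop :: "'q \<Rightarrow> 'q \<Rightarrow> 'q"
  assumes "quandle Q qop"
  shows
    "(\<forall>(A :: 'a set) r \<alpha>.
        right_orderable Q qop \<and> A \<noteq> {} \<and> strict_linear_order_on A r \<and>
        dynamical_cocycle Q qop A \<alpha> \<and>
        (\<forall>x\<in>Q. \<forall>y\<in>Q. lex_order_preserving A r (\<alpha> x y)) \<longrightarrow>
        quandle (Q \<times> A) (dynamical_ext qop \<alpha>) \<and>
        right_orderable (Q \<times> A) (dynamical_ext qop \<alpha>)) \<and>
     (\<forall>(G :: ('b, 'm) monoid_scheme) \<alpha>.
        right_orderable Q qop \<and> comm_group G \<and> right_orderable_group G \<and>
        normalized_cocycle Q qop G \<alpha> \<longrightarrow>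
        quandle (Q \<times> carrier G) (abelian_ext qop G \<alpha>) \<and>
        right_orderable (Q \<times> carrier G) (abelian_ext qop G \<alpha>)) \<and>
     (\<forall>(G :: ('c, 'n) monoid_scheme) \<alpha>.
        comm_group G \<and> carrier G \<noteq> {\<one>\<^bsub>G\<^esub>} \<and>
        normalized_cocycle Q qop G \<alpha> \<longrightarrow>
        quandle (Q \<times> carrier G) (abelian_ext qop G \<alpha>) \<and>
        \<not> left_orderable (Q \<times> carrier G) (abelian_ext qop G \<alpha>))"
proof (intro conjI allI impI; elim conjE)
  fix A :: "'a set" and r \<alpha>
  assume Q: "right_orderable Q qop" and A: "A \<noteq> {}" "strict_linear_order_on A r"
    and \<alpha>: "dynamical_cocycle Q qop A \<alpha>" "\<forall>x\<in>Q. \<forall>y\<in>Q. lex_order_preserving A r (\<alpha> x y)"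
  show "quandle (Q \<times> A) (dynamical_ext qop \<alpha>)"
    by (rule quandle_dynamical_ext[OF assms A(1) \<alpha>(1)])
  show "right_orderable (Q \<times> A) (dynamical_ext qop \<alpha>)"
    by (rule right_orderable_dynamical_ext[OF Q A(2) \<alpha>(1)]) (use \<alpha>(2) in blast)
next
  fix G :: "('b, 'm) monoid_scheme" and \<alpha>
  assume Q: "right_orderable Q qop" and G: "comm_group G" "right_orderable_group G"
    and \<alpha>: "normalized_cocycle Q qop G \<alpha>"
  show "quandle (Q \<times> carrier G) (abelian_ext qop G \<alpha>)"
    by (rule quandle_abelian_ext[OF assms comm_group.axioms(2)[OF G(1)] \<alpha>])
  show "right_orderable (Q \<times> carrier G) (abelian_ext qop G \<alpha>)"
    by (rule right_orderable_abelian_ext[OF assms Q G(2) \<alpha>])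
next
  fix G :: "('c, 'n) monoid_scheme" and \<alpha>
  assume G: "comm_group G" "carrier G \<noteq> {\<one>\<^bsub>G\<^esub>}" and \<alpha>: "normalized_cocycle Q qop G \<alpha>"
  show "quandle (Q \<times> carrier G) (abelian_ext qop G \<alpha>)"
    by (rule quandle_abelian_ext[OF assms comm_group.axioms(2)[OF G(1)] \<alpha>])
  show "\<not> left_orderable (Q \<times> carrier G) (abelian_ext qop G \<alpha>)"
    by (rule not_left_orderable_abelian_ext[OF quandle.nonempty[OF assms]
          comm_group.axioms(2)[OF G(1)] G(2)])
qed

end
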